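(* Let $G_j=G_j(\{x\})$ satisfy $0<G_j\le 1-\alpha_j^\uparrow$, put $\xi_j^{C}=1+\frac{1}{G_j}$, and let $$\gamma_j=\gamma_j(\xi_j)=\begin{cases}0 & \text{if } \xi_j\le 1,\\ G_j(\xi_j-1) & \text{if } 1\le \xi_j\le \xi_j^{C},\\ 1 & \text{if } \xi_j^{C}\le \xi_j,\end{cases}\qquad \xi_j=\frac{h_j^\downarrow}{\Delta b_j^\uparrow}\quad(\xi_j=+\infty \text{ if } \Delta b_j^\uparrow=0),$$ where $\Delta b_j^\uparrow$ is independent of $\{h\}=(h_1,\dots,h_J)$ and satisfies $$\Delta b_j^\uparrow\ge\max\Big[\big|\tfrac{\Delta b_j}{2}-\alpha_{j-1/2}^{+}\Delta b_{j-1/2}\big|,\ \big|\tfrac{\Delta b_j}{2}\big|,\ \big|\tfrac{\Delta b_j}{2}-\alpha_j(b_{j+1}-b_{j-1})\big|,\ \big|\tfrac{\Delta b_j}{2}-\alpha_{j+1/2}^{-}\Delta b_{j+1/2}\big|\Big].$$ Then the depth reconstruction with gradient $[h_x]_j=(1-\gamma_j)[h_x]_j^h+\gamma_j[h_x]_j^\eta$ and interface values $h_{j-1/2}^+$, $h_{j+1/2}^-$ satisfies the following. (i) It is self-monotone. (ii) $$\frac{\partial h_{j-1/2}^+}{\partial h_{j-1}}\ge -G_j\alpha_{j-1/2}^{+}\ge-\frac14,\qquad \frac{\partial h_{j+1/2}^-}{\partial h_{j+1}}\ge -G_j\alpha_{j+1/2}^{-}\ge-\frac14.$$ (iii) $$\Big(1-\frac1{\xi_j^{C}}\Big)h_j^\downarrow\le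 h_{j-1/2}^+\le h_j^\uparrow+\frac{h_j^\downarrow}{\xi_j^{C}},\qquad \Big(1-\frac1{\xi_j^{C}}\Big)h_j^\downarrow\le h_{j+1/2}^-\le h_j^\uparrow+\frac{h_j^\downarrow}{\xi_j^{C}}.$$
   Context: Grid: $\{x\}=(x_{1/2}<x_{3/2}<\dots<x_{J+1/2})$, cells $C_j=(x_{j-1/2},x_{j+1/2})$, $\Delta x_j=x_{j+1/2}-x_{j-1/2}$; $j$ is a cell with neighbours $j-1,j+1$. The cell average depths satisfy $h_k\ge0$. The bed elevation has known values $b_{k-1/2}^+,b_{k+1/2}^-$ at the two ends of each cell $C_k$ (discontinuities at interfaces allowed), with $b_k=\frac12(b_{k-1/2}^++b_{k+1/2}^-)$, $\Delta b_k=b_{k+1/2}^--b_{k-1/2}^+$, $[b_x]_k=\Delta b_k/\Delta x_k$. The surface elevation is $\eta_k=h_k+b_k$. For any field $v$, $\Delta v_{k+1/2}=v_{k+1}-v_k$. Minmod: $\operatorname{minmod}[y_1,\dots,y_n]$ equals $\min_i y_i$ if $\min_i y_i>0$, $\max_i y_i$ if $\max_i y_i<0$, and $0$ otherwise. The slope limiter is $$\sigma(v_{j-1},v_j,v_{j+1};\{x\})=\frac{2}{\Delta x_j}\operatorname{minmod}\big[\alpha_{j-1/2}^{+}(v_j-v_{j-1}),\ \alpha_j(v_{j+1}-v_{j-1}),\ \alpha_{j+1/2}^{-}(v_{j+1}-v_j)\big],$$ with parameters $\alpha_j,\alpha_{j-1/2}^+,\alpha_{j+1/2}^-$ functions of $\{x\}$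 with values in $[0,1]$; $\alpha_j^\uparrow=\max[\alpha_{j-1/2}^+,\alpha_{j+1/2}^-]$. Two gradients: $[h_x]_j^h=\sigma(h_{j-1},h_j,h_{j+1};\{x\})$ and $[h_x]_j^\eta=\sigma(\eta_{j-1},\eta_j,\eta_{j+1};\{x\})-[b_x]_j$. The reconstruction on $C_j$ is the linear function $\hat h$ with cell average $h_j$ and gradient $[h_x]_j$, and $h_{j-1/2}^+=h_j-\frac{\Delta x_j}{2}[h_x]_j$, $h_{j+1/2}^-=h_j+\frac{\Delta x_j}{2}[h_x]_j$ are its interface values. $h_j^\downarrow=\min[h_j-\alpha_{j-1/2}^+\Delta h_{j-1/2},\,h_j,\,h_j+\alpha_{j+1/2}^-\Delta h_{j+1/2}]$, and $h_j^\uparrow$ is the maximum of the same three quantities. Self-monotone: for each $x\in C_j$, $\hat h(x)$ is a non-decreasing function of $h_j$ (all other data fixed). Since the reconstruction is only piecewise differentiable in the data, inequalities on partial derivatives are understood for left and right partial derivatives at points of non-differentiability. *)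

theory Defs
  imports "HOL-Analysis.Analysis"
begin

text \<open>
  Cells are indexed by integers. Quantities living at the half-integer interfaces are stored
  under integer indices as follows, for a cell \<open>k\<close>:
  \<open>x k\<close> is $x_{k-1/2}$, so that $C_k$ is the interval from \<open>x k\<close> to \<open>x (k + 1)\<close>;
  \<open>bp k\<close> is $b_{k-1/2}^+$ and \<open>bm k\<close> is $b_{k+1/2}^-$ (the two ends of $C_k$);
  \<open>\<alpha>p k\<close> is $\alpha_{k-1/2}^+$, \<open>\<alpha>c k\<close> is $\alpha_k$ and \<open>\<alpha>m k\<close> is $\alpha_{k+1/2}^-$.
\<close>

definition cell :: "(int \<Rightarrow> real) \<Rightarrow> int \<Rightarrow> real set" where
  "cell x k = {x k <..< x (k + 1)}"

definition cell_width :: "(int \<Rightarrow> real) \<Rightarrow> int \<Rightarrow> real" where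
  "cell_width x k = x (k + 1) - x k"

definition bed_mean :: "(int \<Rightarrow> real) \<Rightarrow> (int \<Rightarrow> real) \<Rightarrow> int \<Rightarrow> real" where
  "bed_mean bp bm k = (bp k + bm k) / 2"

definition bed_jump :: "(int \<Rightarrow> real) \<Rightarrow> (int \<Rightarrow> real) \<Rightarrow> int \<Rightarrow> real" where
  "bed_jump bp bm k = bm k - bp k"

definition bed_slope :: "(int \<Rightarrow> real) \<Rightarrow> (int \<Rightarrow> real) \<Rightarrow> (int \<Rightarrow> real) \<Rightarrow> int \<Rightarrow> real" where
  "bed_slope x bp bm k = bed_jump bp bm k / cell_width x k"

definition surface :: "(int \<Rightarrow> real) \<Rightarrow> (int \<Rightarrow> real) \<Rightarrow> (int \<Rightarrow> real) \<Rightarrow> int \<Rightarrow> real" where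
  "surface bp bm h k = h k + bed_mean bp bm k"

definition minmod :: "real list \<Rightarrow> real" where
  "minmod ys = (if Min (set ys) > 0 then Min (set ys)
                else if Max (set ys) < 0 then Max (set ys) else 0)"

definition limited_slope ::
  "(int \<Rightarrow> real) \<Rightarrow> (int \<Rightarrow> real) \<Rightarrow> (int \<Rightarrow> real) \<Rightarrow> (int \<Rightarrow> real) \<Rightarrow> (int \<Rightarrow> real) \<Rightarrow> int \<Rightarrow> real" where
  "limited_slope x \<alpha>p \<alpha>c \<alpha>m v j =
     2 / cell_width x j *
     minmod [\<alpha>p j * (v j - v (j - 1)), \<alpha>c j * (v (j + 1) - v (j - 1)), \<alpha>m j * (v (j + 1) - v j)]"

definition grad_h ::
  "(int \<Rightarrow> real) \<Rightarrow> (int \<Rightarrow> real) \<Rightarrow> (int \<Rightarrow> real) \<Rightarrow> (int \<Rightarrow> real) \<Rightarrow> (int \<Rightarrow> real) \<Rightarrow> int \<Rightarrow> real" where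
  "grad_h x \<alpha>p \<alpha>c \<alpha>m h j = limited_slope x \<alpha>p \<alpha>c \<alpha>m h j"

definition grad_eta ::
  "(int \<Rightarrow> real) \<Rightarrow> (int \<Rightarrow> real) \<Rightarrow> (int \<Rightarrow> real) \<Rightarrow> (int \<Rightarrow> real) \<Rightarrow> (int \<Rightarrow> real) \<Rightarrow> (int \<Rightarrow> real)
   \<Rightarrow> (int \<Rightarrow> real) \<Rightarrow> int \<Rightarrow> real" where
  "grad_eta x \<alpha>p \<alpha>c \<alpha>m bp bm h j =
     limited_slope x \<alpha>p \<alpha>c \<alpha>m (surface bp bm h) j - bed_slope x bp bm j"

definition h_down :: "(int \<Rightarrow> real) \<Rightarrow> (int \<Rightarrow> real) \<Rightarrow> (int \<Rightarrow> real) \<Rightarrow> int \<Rightarrow> real" where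
  "h_down \<alpha>p \<alpha>m h j =
     Min {h j - \<alpha>p j * (h j - h (j - 1)), h j, h j + \<alpha>m j * (h (j + 1) - h j)}"

definition h_up :: "(int \<Rightarrow> real) \<Rightarrow> (int \<Rightarrow> real) \<Rightarrow> (int \<Rightarrow> real) \<Rightarrow> int \<Rightarrow> real" where
  "h_up \<alpha>p \<alpha>m h j =
     Max {h j - \<alpha>p j * (h j - h (j - 1)), h j, h j + \<alpha>m j * (h (j + 1) - h j)}"

definition xi_crit :: "real \<Rightarrow> real" where
  "xi_crit g = 1 + 1 / g"

definition blend_weight :: "real \<Rightarrow> ereal \<Rightarrow> real" where
  "blend_weight g \<xi> =
     (if \<xi> \<le> 1 then 0 else if \<xi> \<le> ereal (xi_crit g) then g * (real_of_ereal \<xi> - 1) else 1)"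

text \<open>The argument \<open>B\<close> is $\Delta b_j^\uparrow$ below; the ratio is infinite when it vanishes.\<close>

definition depth_ratio :: "real \<Rightarrow> real \<Rightarrow> ereal" where
  "depth_ratio d B = (if B = 0 then \<infinity> else ereal (d / B))"

definition blended_grad ::
  "(int \<Rightarrow> real) \<Rightarrow> (int \<Rightarrow> real) \<Rightarrow> (int \<Rightarrow> real) \<Rightarrow> (int \<Rightarrow> real) \<Rightarrow> (int \<Rightarrow> real) \<Rightarrow> (int \<Rightarrow> real)
   \<Rightarrow> (int \<Rightarrow> real) \<Rightarrow> (int \<Rightarrow> real) \<Rightarrow> (int \<Rightarrow> real) \<Rightarrow> int \<Rightarrow> real" where
  "blended_grad x \<alpha>p \<alpha>c \<alpha>m bp bm G B h j =
     (let \<gamma> = blend_weight (G j) (depth_ratio (h_down \<alpha>p \<alpha>m h j) (B j))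
      in (1 - \<gamma>) * grad_h x \<alpha>p \<alpha>c \<alpha>m h j + \<gamma> * grad_eta x \<alpha>p \<alpha>c \<alpha>m bp bm h j)"

text \<open>
  A reconstruction is given by its gradient \<open>g h j\<close> on $C_j$ as a function of the cell averages
  \<open>h\<close>. The linear function with mean \<open>h j\<close> over $C_j$ takes that value at the midpoint.
\<close>

definition recon ::
  "(int \<Rightarrow> real) \<Rightarrow> ((int \<Rightarrow> real) \<Rightarrow> int \<Rightarrow> real) \<Rightarrow> (int \<Rightarrow> real) \<Rightarrow> int \<Rightarrow> real \<Rightarrow> real" where
  "recon x g h j y = h j + g h j * (y - (x j + x (j + 1)) / 2)"

definition left_value ::
  "(int \<Rightarrow> real) \<Rightarrow> ((int \<Rightarrow> real) \<Rightarrow> int \<Rightarrow> real) \<Rightarrow> int \<Rightarrow> (int \<Rightarrow> real) \<Rightarrow> real" where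
  "left_value x g j h = h j - cell_width x j / 2 * g h j"

definition right_value ::
  "(int \<Rightarrow> real) \<Rightarrow> ((int \<Rightarrow> real) \<Rightarrow> int \<Rightarrow> real) \<Rightarrow> int \<Rightarrow> (int \<Rightarrow> real) \<Rightarrow> real" where
  "right_value x g j h = h j + cell_width x j / 2 * g h j"

lemma recon_interface_values:
  "recon x g h j (x j) = left_value x g j h"
  "recon x g h j (x (j + 1)) = right_value x g j h"
  by (simp_all add: recon_def left_value_def right_value_def cell_width_def field_simps)

lemma recon_cell_average:
  assumes "x j < x (j + 1)"
  shows "integral (cell x j) (recon x g h j) / cell_width x j = h j"
proof -
  let ?F = "\<lambda>y. h j * y + g h j * (y - (x j + x (j + 1)) / 2)^2 / 2"
  have "(recon x g h j has_integral (?F (x (j + 1)) - ?F (x j))) {x j .. x (j + 1)}"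
    using assms
    by (intro fundamental_theorem_of_calculus)
       (auto intro!: derivative_eq_intros
             simp: recon_def has_real_derivative_iff_has_vector_derivative [symmetric])
  moreover have "?F (x (j + 1)) - ?F (x j) = h j * cell_width x j"
    by (simp add: cell_width_def power2_eq_square field_simps)
  ultimately have "(recon x g h j has_integral h j * cell_width x j) {x j <..< x (j + 1)}"
    by (metis box_real(1) cbox_interval has_integral_open_interval)
  then show ?thesis
    using assms by (simp add: cell_def cell_width_def integral_unique)
qed

text \<open>Depths are nonnegative, so \<open>h j\<close> varies over the nonnegative reals.\<close>

definition self_monotone ::
  "(int \<Rightarrow> real) \<Rightarrow> ((int \<Rightarrow> real) \<Rightarrow> int \<Rightarrow> real) \<Rightarrow> (int \<Rightarrow> real) \<Rightarrow> int \<Rightarrow> bool" where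
  "self_monotone x g h j \<longleftrightarrow>
     (\<forall>y \<in> cell x j. mono_on {0..} (\<lambda>u. recon x g (h(j := u)) j y))"

text \<open>
  Lower bound on the partial derivative of \<open>F\<close> with respect to \<open>h k\<close>: the right derivative, and
  the left derivative unless \<open>h k = 0\<close> is the boundary of the range of admissible depths, exist
  and are bounded below. Where \<open>F\<close> is differentiable both are the ordinary partial derivative.
\<close>

definition partial_ge :: "((int \<Rightarrow> real) \<Rightarrow> real) \<Rightarrow> int \<Rightarrow> (int \<Rightarrow> real) \<Rightarrow> real \<Rightarrow> bool" where
  "partial_ge F k h c \<longleftrightarrow>
     (\<exists>D. ((\<lambda>u. F (h(k := u))) has_real_derivative D) (at_right (h k)) \<and> D \<ge> c) \<and>
     (h k > 0 \<longrightarrow>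
       (\<exists>D. ((\<lambda>u. F (h(k := u))) has_real_derivative D) (at_left (h k)) \<and> D \<ge> c))"

end

theory Submission
  imports Defs
begin

text \<open>
  Multiplying every gradient by half the cell width turns it into the rise of the reconstruction
  from the centre of the cell to its right end; the interface values are then the cell average
  minus and plus this rise. Write \<open>\<sigma>\<close> and \<open>\<tau>\<close> for the rises belonging to the depth gradient and to
  the surface gradient, \<open>D\<close> for the lower depth $h_j^\downarrow$, \<open>B\<close> for the bound
  $\Delta b_j^\uparrow$, \<open>g\<close> for $G_j$ and \<open>w\<close> for the weight $\gamma_j$, so that the blended rise is \<open>(1 - w) * \<sigma> + w * \<tau>\<close>.

  Two facts carry the proof. First, minmod is the projection of zero onto the interval spanned by
  its arguments. The projection of \<open>c\<close> onto the interval spanned by \<open>y\<^sub>1\<close>, \<open>y\<^sub>2\<close>, \<open>y\<^sub>3\<close> is monotone in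
  all four of these numbers and commutes with translations, hence it is \<open>1\<close>-Lipschitz for the
  maximum norm (\<open>clamp3_lipschitz\<close>). The rise \<open>\<tau>\<close> is such a projection with the data of \<open>\<sigma>\<close> moved by
  the four quantities that \<open>B\<close> dominates, so \<open>\<bar>\<sigma> - \<tau>\<bar> \<le> B\<close>. Secondly, \<open>w * B\<close> as a function of
  \<open>D\<close> is flat, then rises with slope \<open>g\<close>, then is flat again, and it never exceeds \<open>D / xi_crit g\<close>
  for \<open>D \<ge> 0\<close>: for \<open>B > 0\<close> the graph meets this line at the origin, then lies below it, and meets it
  once more at its second corner, where \<open>D = xi_crit g * B\<close> and \<open>w\<close> reaches \<open>1\<close>.

  The second fact gives the bounds on the interface values, because the blended rise differs
  from \<open>\<sigma>\<close> by at most \<open>w * B\<close>. Both facts together give an increment estimate: if the data change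
  such that \<open>\<sigma>\<close> and \<open>\<tau>\<close> increase by at most \<open>L\<close> and \<open>D\<close> changes by at most \<open>K\<close>, then the blended
  rise increases by at most \<open>L + g * K\<close> (\<open>blend_increment\<close>). When the depth of the cell itself
  changes by \<open>t\<close>, then \<open>L\<close> is the larger interface parameter times \<open>t\<close> and \<open>K = t\<close>; since
  \<open>g\<close> is at most one minus that parameter, the rise changes by no more than \<open>t\<close>, which is
  self-monotonicity. When the depth of a neighbour increases, \<open>\<sigma>\<close> and \<open>\<tau>\<close> move in the favourable
  direction, so \<open>L = 0\<close>, and \<open>K\<close> is the interface parameter times the change; this is the bound on
  the partial derivatives. The one-sided derivatives exist since everything is built from smooth
  functions by sums, products, maxima and minima, and they inherit the bound on difference quotients.
\<close>

section \<open>Projection onto the interval spanned by three numbers\<close>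

definition clamp3 :: "real \<Rightarrow> real \<Rightarrow> real \<Rightarrow> real \<Rightarrow> real" where
  "clamp3 c y1 y2 y3 = max (min y1 (min y2 y3)) (min c (max y1 (max y2 y3)))"

lemma minmod_eq_clamp3: "minmod [y1, y2, y3] = clamp3 0 y1 y2 y3"
  by (auto simp: minmod_def clamp3_def max_def min_def)

lemma clamp3_mono:
  assumes "c \<le> c'" "y1 \<le> z1" "y2 \<le> z2" "y3 \<le> z3"
  shows "clamp3 c y1 y2 y3 \<le> clamp3 c' z1 z2 z3"
  unfolding clamp3_def using assms by (intro max.mono min.mono)

lemma clamp3_translate:
  "clamp3 (c + t) (y1 + t) (y2 + t) (y3 + t) = clamp3 c y1 y2 y3 + t"
  by (simp add: clamp3_def max_add_distrib_left min_add_distrib_left)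

text \<open>
  A monotone function that commutes with translations cannot increase by more than the largest
  increase of its arguments.
\<close>

lemma clamp3_increment:
  assumes "c' \<le> c + L" "z1 \<le> y1 + L" "z2 \<le> y2 + L" "z3 \<le> y3 + L"
  shows "clamp3 c' z1 z2 z3 \<le> clamp3 c y1 y2 y3 + L"
  using clamp3_mono[OF assms] by (simp add: clamp3_translate)

lemma clamp3_lipschitz:
  assumes "\<bar>c' - c\<bar> \<le> L" "\<bar>z1 - y1\<bar> \<le> L" "\<bar>z2 - y2\<bar> \<le> L" "\<bar>z3 - y3\<bar> \<le> L"
  shows "\<bar>clamp3 c' z1 z2 z3 - clamp3 c y1 y2 y3\<bar> \<le> L"
  using clamp3_increment[of c' c L z1 y1 z2 y2 z3 y3]
    clamp3_increment[of c c' L y1 z1 y2 z2 y3 z3] assms by linarith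

lemma clamp3_between:
  "min c y1 \<le> clamp3 c y1 y2 y3" "clamp3 c y1 y2 y3 \<le> max c y1"
  "min c y3 \<le> clamp3 c y1 y2 y3" "clamp3 c y1 y2 y3 \<le> max c y3"
  by (auto simp: clamp3_def max_def min_def)

section \<open>The blending weight\<close>

lemma blend_weight_depth_ratio_zero: "blend_weight g (depth_ratio D 0) = 1"
  by (simp add: blend_weight_def depth_ratio_def)

lemma blend_weight_depth_ratio_pos:
  assumes "0 < g" "0 < B"
  shows "blend_weight g (depth_ratio D B) = max 0 (min 1 (g * (D / B - 1)))"
proof -
  have "g * (D / B - 1) \<le> 1 \<longleftrightarrow> D / B \<le> xi_crit g"
    using assms by (simp add: xi_crit_def field_simps)
  moreover have "g * (D / B - 1) \<le> 0 \<longleftrightarrow> D / B \<le> 1"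
    using assms by (simp add: mult_le_0_iff)
  ultimately show ?thesis
    using assms by (auto simp: blend_weight_def depth_ratio_def one_ereal_def
        simp del: ereal_eq_1)
qed

lemma blend_weight_bounds:
  assumes "0 < g" "0 \<le> B"
  shows "0 \<le> blend_weight g (depth_ratio D B)" "blend_weight g (depth_ratio D B) \<le> 1"
  using assms blend_weight_depth_ratio_pos[of g B D] blend_weight_depth_ratio_zero[of g D]
  by (cases "B = 0"; simp)+

text \<open>
  In the middle range the claim reads \<open>g * (D - B) \<le> D * g / (1 + g)\<close>, which is the inequality
  \<open>D / B \<le> xi_crit g\<close> that defines this range; beyond it, the claim is the reverse inequality.
\<close>

lemma blend_weight_times_le:
  assumes g: "0 < g" and B: "0 \<le> B" and D: "0 \<le> D"
  shows "blend_weight g (depth_ratio D B) * B \<le> D / xi_crit g"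
proof (cases "B = 0")
  case False
  with B have B: "0 < B" by simp
  have xi: "D / xi_crit g = D * g / (1 + g)"
    using g by (simp add: xi_crit_def field_simps)
  have D_ge: "0 \<le> D * g / (1 + g)" using g D by simp
  let ?w = "min 1 (g * (D / B - 1))"
  have mid: "?w * B \<le> D * g / (1 + g)"
  proof (cases "D * g \<le> B * (1 + g)")
    case True
    have "?w * B \<le> g * (D / B - 1) * B"
      using B by (intro mult_right_mono) auto
    also have "\<dots> = g * (D - B)" using B by (simp add: field_simps)
    also have "\<dots> \<le> D * g / (1 + g)"
    proof -
      have "g * (D * g) \<le> g * (B * (1 + g))"
        using True g by (intro mult_left_mono) auto
      then show ?thesis using g by (simp add: field_simps)
    qed
    finally show ?thesis .
  next
    case False
    have "?w * B \<le> 1 * B"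
      using B by (intro mult_right_mono) auto
    also have "\<dots> \<le> D * g / (1 + g)" using False g by (simp add: field_simps)
    finally show ?thesis .
  qed
  show ?thesis
    using mid D_ge unfolding blend_weight_depth_ratio_pos[OF g B] xi
    by (simp add: max_def)
qed (use assms in \<open>simp add: xi_crit_def\<close>)

lemma blend_weight_increment:
  assumes g: "0 < g" and B: "0 \<le> B"
  shows "\<bar>blend_weight g (depth_ratio D' B) - blend_weight g (depth_ratio D B)\<bar> * B \<le> g * \<bar>D' - D\<bar>"
proof (cases "B = 0")
  case False
  with B have B: "0 < B" by simp
  let ?f = "\<lambda>D. g * (D / B - 1)"
  have "\<bar>max 0 (min 1 (?f D')) - max 0 (min 1 (?f D))\<bar> \<le> \<bar>?f D' - ?f D\<bar>"
    by (simp add: max_def min_def)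
  also have "?f D' - ?f D = g / B * (D' - D)"
    by (simp add: algebra_simps diff_divide_distrib)
  also have "\<bar>g / B * (D' - D)\<bar> = g * \<bar>D' - D\<bar> / B"
    using g B by (simp add: abs_mult)
  finally show ?thesis
    using B by (simp add: blend_weight_depth_ratio_pos[OF g B] pos_le_divide_eq)
qed (use g in simp)

definition blend :: "real \<Rightarrow> real \<Rightarrow> real \<Rightarrow> real \<Rightarrow> real \<Rightarrow> real" where
  "blend g B D \<sigma> \<tau> =
     (1 - blend_weight g (depth_ratio D B)) * \<sigma> + blend_weight g (depth_ratio D B) * \<tau>"

lemma blend_deviation:
  assumes g: "0 < g" and D: "0 \<le> D" and \<sigma>\<tau>: "\<bar>\<sigma> - \<tau>\<bar> \<le> B"
  shows "\<bar>blend g B D \<sigma> \<tau> - \<sigma>\<bar> \<le> D / xi_crit g"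
proof -
  have B: "0 \<le> B" using \<sigma>\<tau> by linarith
  let ?w = "blend_weight g (depth_ratio D B)"
  have "blend g B D \<sigma> \<tau> - \<sigma> = ?w * (\<tau> - \<sigma>)"
    by (simp add: blend_def algebra_simps)
  also have "\<bar>?w * (\<tau> - \<sigma>)\<bar> = ?w * \<bar>\<sigma> - \<tau>\<bar>"
    using blend_weight_bounds[OF g B] by (simp add: abs_mult abs_minus_commute)
  also have "\<dots> \<le> ?w * B"
    using blend_weight_bounds[OF g B] \<sigma>\<tau> by (intro mult_left_mono)
  also have "\<dots> \<le> D / xi_crit g"
    by (rule blend_weight_times_le[OF g B D])
  finally show ?thesis .
qed

text \<open>
  Product rule for increments: the new weight averages the increments of \<open>\<sigma>\<close> and \<open>\<tau>\<close>, and the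
  increment of the weight is multiplied by \<open>\<tau> - \<sigma>\<close>, which compensates the division by \<open>B\<close> in the
  argument of the weight.
\<close>

lemma blend_increment:
  assumes g: "0 < g" and \<sigma>\<tau>: "\<bar>\<sigma> - \<tau>\<bar> \<le> B"
    and L: "\<sigma>' - \<sigma> \<le> L" "\<tau>' - \<tau> \<le> L" and K: "\<bar>D' - D\<bar> \<le> K"
  shows "blend g B D' \<sigma>' \<tau>' - blend g B D \<sigma> \<tau> \<le> L + g * K"
proof -
  have B: "0 \<le> B" using \<sigma>\<tau> by linarith
  let ?w = "blend_weight g (depth_ratio D B)" and ?w' = "blend_weight g (depth_ratio D' B)"
  note w' = blend_weight_bounds[OF g B, of D']
  have "blend g B D' \<sigma>' \<tau>' - blend g B D \<sigma> \<tau>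
      = ((1 - ?w') * (\<sigma>' - \<sigma>) + ?w' * (\<tau>' - \<tau>)) + (?w' - ?w) * (\<tau> - \<sigma>)"
    by (simp add: blend_def algebra_simps)
  moreover have "(1 - ?w') * (\<sigma>' - \<sigma>) + ?w' * (\<tau>' - \<tau>) \<le> L"
    using convex_bound_le[OF L, of "1 - ?w'" ?w'] w' by simp
  moreover have "(?w' - ?w) * (\<tau> - \<sigma>) \<le> g * K"
  proof -
    have "(?w' - ?w) * (\<tau> - \<sigma>) \<le> \<bar>?w' - ?w\<bar> * \<bar>\<sigma> - \<tau>\<bar>"
      by (metis abs_ge_self abs_minus_commute abs_mult)
    also have "\<dots> \<le> \<bar>?w' - ?w\<bar> * B" using \<sigma>\<tau> by (intro mult_left_mono) auto
    also have "\<dots> \<le> g * \<bar>D' - D\<bar>" by (rule blend_weight_increment[OF g B])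
    also have "\<dots> \<le> g * K" using g K by (intro mult_left_mono) auto
    finally show ?thesis .
  qed
  ultimately show ?thesis by linarith
qed

section \<open>One-sided differentiability\<close>

text \<open>
  Unlike two-sided differentiability, differentiability from one side is preserved by the absolute
  value, also at a zero of \<open>f\<close>: there the difference quotient of \<open>\<bar>f\<bar>\<close> is the absolute value of that
  of \<open>f\<close>, up to the constant sign \<open>s\<close> of \<open>x - a\<close>.
\<close>

lemma field_differentiable_abs_one_sided:
  fixes f :: "real \<Rightarrow> real"
  assumes f: "f field_differentiable (at a within S)" and S: "\<And>x. x \<in> S \<Longrightarrow> sgn (x - a) = s"
  shows "(\<lambda>x. \<bar>f x\<bar>) field_differentiable (at a within S)"
proof -
  obtain d where d: "(f has_field_derivative d) (at a within S)"
    using f by (auto simp: field_differentiable_def)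
  show ?thesis
  proof (cases "f a = 0")
    case True
    have "((\<lambda>x. s * \<bar>(f x - f a) / (x - a)\<bar>) \<longlongrightarrow> s * \<bar>d\<bar>) (at a within S)"
      using d by (intro tendsto_intros) (simp add: has_field_derivative_iff)
    moreover have "\<forall>\<^sub>F x in at a within S.
        s * \<bar>(f x - f a) / (x - a)\<bar> = (\<bar>f x\<bar> - \<bar>f a\<bar>) / (x - a)"
      unfolding eventually_at_filter
    proof (intro always_eventually allI impI)
      fix x assume "x \<noteq> a" "x \<in> S"
      have "s * \<bar>f x / (x - a)\<bar> = \<bar>f x\<bar> * (sgn (x - a) / \<bar>x - a\<bar>)"
        using S[OF \<open>x \<in> S\<close>] by (simp add: abs_divide)
      also have "sgn (x - a) / \<bar>x - a\<bar> = 1 / (x - a)"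
        using \<open>x \<noteq> a\<close> by (auto simp: sgn_if divide_simps)
      finally show "s * \<bar>(f x - f a) / (x - a)\<bar> = (\<bar>f x\<bar> - \<bar>f a\<bar>) / (x - a)"
        using True by simp
    qed
    ultimately have "((\<lambda>x. \<bar>f x\<bar>) has_field_derivative s * \<bar>d\<bar>) (at a within S)"
      unfolding has_field_derivative_iff by (rule Lim_transform_eventually)
    then show ?thesis by (auto simp: field_differentiable_def)
  next
    case False
    have "(f \<longlongrightarrow> f a) (at a within S)"
      using DERIV_continuous[OF d] by (simp add: continuous_within)
    then have "((\<lambda>x. sgn (f a) * f x) \<longlongrightarrow> sgn (f a) * f a) (at a within S)"
      by (intro tendsto_intros)
    then have "\<forall>\<^sub>F x in at a within S. 0 < sgn (f a) * f x"
      by (rule order_tendstoD(1)) (use False in \<open>auto simp: sgn_if\<close>)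
    then have "\<forall>\<^sub>F x in at a within S. \<bar>f x\<bar> = sgn (f a) * f x"
      by (rule eventually_mono) (use False in \<open>auto simp: sgn_if split: if_splits\<close>)
    moreover have "((\<lambda>x. sgn (f a) * f x) has_field_derivative sgn (f a) * d) (at a within S)"
      using d by (rule DERIV_cmult)
    ultimately have "((\<lambda>x. \<bar>f x\<bar>) has_field_derivative sgn (f a) * d) (at a within S)"
      by (subst has_field_derivative_cong_eventually) (auto simp: abs_sgn mult.commute)
    then show ?thesis by (auto simp: field_differentiable_def)
  qed
qed

lemma field_differentiable_max_one_sided:
  fixes f g :: "real \<Rightarrow> real"
  assumes "f field_differentiable (at a within S)" "g field_differentiable (at a within S)"
    and "\<And>x. x \<in> S \<Longrightarrow> sgn (x - a) = s"
  shows "(\<lambda>x. max (f x) (g x)) field_differentiable (at a within S)"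
proof -
  have "(\<lambda>x. max (f x) (g x)) = (\<lambda>x. (f x + g x + \<bar>f x - g x\<bar>) * (1 / 2))"
    by (auto simp: max_def fun_eq_iff)
  moreover have "(\<lambda>x. (f x + g x + \<bar>f x - g x\<bar>) * (1 / 2)) field_differentiable (at a within S)"
    using assms
    by (intro field_differentiable_mult field_differentiable_add field_differentiable_const
        field_differentiable_abs_one_sided field_differentiable_diff)
  ultimately show ?thesis by simp
qed

lemma field_differentiable_min_one_sided:
  fixes f g :: "real \<Rightarrow> real"
  assumes "f field_differentiable (at a within S)" "g field_differentiable (at a within S)"
    and "\<And>x. x \<in> S \<Longrightarrow> sgn (x - a) = s"
  shows "(\<lambda>x. min (f x) (g x)) field_differentiable (at a within S)"
proof -
  have "(\<lambda>x. min (f x) (g x)) = (\<lambda>x. - max (- f x) (- g x))"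
    by (auto simp: max_def min_def fun_eq_iff)
  then show ?thesis
    using assms by (simp add: field_differentiable_minus field_differentiable_max_one_sided)
qed

lemmas one_sided_intros = field_differentiable_max_one_sided field_differentiable_min_one_sided
  field_differentiable_add field_differentiable_diff field_differentiable_mult
  field_differentiable_const field_differentiable_ident

lemma clamp3_one_sided:
  fixes c f1 f2 f3 :: "real \<Rightarrow> real"
  assumes "c field_differentiable (at a within S)" "f1 field_differentiable (at a within S)"
    "f2 field_differentiable (at a within S)" "f3 field_differentiable (at a within S)"
    and "\<And>x. x \<in> S \<Longrightarrow> sgn (x - a) = s"
  shows "(\<lambda>x. clamp3 (c x) (f1 x) (f2 x) (f3 x)) field_differentiable (at a within S)"
  unfolding clamp3_def using assms by (intro one_sided_intros)

lemma blend_one_sided: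
  fixes D \<sigma> \<tau> :: "real \<Rightarrow> real"
  assumes g: "0 < g" and B: "0 \<le> B"
    and D: "D field_differentiable (at a within S)"
    and \<sigma>: "\<sigma> field_differentiable (at a within S)"
    and \<tau>: "\<tau> field_differentiable (at a within S)"
    and S: "\<And>x. x \<in> S \<Longrightarrow> sgn (x - a) = s"
  shows "(\<lambda>x. blend g B (D x) (\<sigma> x) (\<tau> x)) field_differentiable (at a within S)"
proof (cases "B = 0")
  case True
  then show ?thesis using \<tau> by (simp add: blend_def blend_weight_depth_ratio_zero)
next
  case False
  with B have B: "0 < B" by simp
  have "(\<lambda>x. blend_weight g (depth_ratio (D x) B)) field_differentiable (at a within S)"
    unfolding blend_weight_depth_ratio_pos[OF g B] divide_inverse
    using D S by (intro one_sided_intros)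
  then show ?thesis
    unfolding blend_def using \<sigma> \<tau> by (intro one_sided_intros)
qed

text \<open>
  A one-sided derivative is a limit of difference quotients, so it inherits their lower bound.
  To the left of the point, the increment of the argument is negative and the two arguments change
  roles.
\<close>

lemma partial_ge_of_increments:
  assumes right: "(\<lambda>u. F (h(k := u))) field_differentiable (at_right (h k))"
    and left: "(\<lambda>u. F (h(k := u))) field_differentiable (at_left (h k))"
    and incr: "\<And>u v. u \<le> v \<Longrightarrow> c * (v - u) \<le> F (h(k := v)) - F (h(k := u))"
  shows "partial_ge F k h c"
proof -
  have ge: "c \<le> D"
    if D: "((\<lambda>u. F (h(k := u))) has_real_derivative D) (at (h k) within S)"
      and nontriv: "at (h k) within S \<noteq> bot" for D S
  proof (rule tendsto_lowerbound[OF D[unfolded has_field_derivative_iff] _ nontriv])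
    show "\<forall>\<^sub>F v in at (h k) within S. c \<le> (F (h(k := v)) - F (h(k := h k))) / (v - h k)"
      unfolding eventually_at_filter
    proof (intro always_eventually allI impI)
      fix v assume "v \<noteq> h k"
      then consider "h k < v" | "v < h k" by linarith
      then show "c \<le> (F (h(k := v)) - F (h(k := h k))) / (v - h k)"
      proof cases
        case 1
        then show ?thesis using incr[of "h k" v] by (simp add: field_simps)
      next
        case 2
        then show ?thesis using incr[of v "h k"] by (simp add: field_simps)
      qed
    qed
  qed
  show ?thesis
    using right left ge[of _ "{h k<..}"] ge[of _ "{..<h k}"]
    unfolding partial_ge_def field_differentiable_def by force
qed

section \<open>The blended rise across half a cell\<close>

text \<open>
  The data of one cell: \<open>a\<close>, \<open>c\<close>, \<open>m\<close> are the limiter parameters, \<open>d\<close> is half the bed jump in the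
  cell, and \<open>e1\<close>, \<open>e2\<close>, \<open>e3\<close> are the differences of bed means times the limiter parameters, less \<open>d\<close>.
  The arguments \<open>p\<close>, \<open>u\<close>, \<open>q\<close> below are the depths in the left cell, the cell itself and the right
  cell.
\<close>

locale cell_limiter =
  fixes a c m g B d e1 e2 e3 :: real
  assumes a: "0 \<le> a" "a \<le> 1" and c: "0 \<le> c" and m: "0 \<le> m" "m \<le> 1"
    and g: "0 < g" "g \<le> 1 - max a m"
    and B: "\<bar>d\<bar> \<le> B" "\<bar>e1\<bar> \<le> B" "\<bar>e2\<bar> \<le> B" "\<bar>e3\<bar> \<le> B"
begin

definition depth_rise :: "real \<Rightarrow> real \<Rightarrow> real \<Rightarrow> real" where
  "depth_rise p u q = clamp3 0 (a * (u - p)) (c * (q - p)) (m * (q - u))"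

text \<open>
  The bed slope has been subtracted inside the projection, which moves its centre from \<open>0\<close> to \<open>- d\<close>.
\<close>

definition surface_rise :: "real \<Rightarrow> real \<Rightarrow> real \<Rightarrow> real" where
  "surface_rise p u q = clamp3 (- d) (a * (u - p) + e1) (c * (q - p) + e2) (m * (q - u) + e3)"

definition low :: "real \<Rightarrow> real \<Rightarrow> real \<Rightarrow> real" where
  "low p u q = min (u - a * (u - p)) (min u (u + m * (q - u)))"

definition high :: "real \<Rightarrow> real \<Rightarrow> real \<Rightarrow> real" where
  "high p u q = max (u - a * (u - p)) (max u (u + m * (q - u)))"

definition rise :: "real \<Rightarrow> real \<Rightarrow> real \<Rightarrow> real" where
  "rise p u q = blend g B (low p u q) (depth_rise p u q) (surface_rise p u q)"

lemma depth_surface_rise_close: "\<bar>depth_rise p u q - surface_rise p u q\<bar> \<le> B"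
  unfolding depth_rise_def surface_rise_def using B by (intro clamp3_lipschitz) auto

lemma rise_increment:
  assumes "depth_rise p' u' q' - depth_rise p u q \<le> L"
    "surface_rise p' u' q' - surface_rise p u q \<le> L" "\<bar>low p' u' q' - low p u q\<bar> \<le> K"
  shows "rise p' u' q' - rise p u q \<le> L + g * K"
  unfolding rise_def using blend_increment[OF g(1) depth_surface_rise_close assms] .

text \<open>
  Among the arguments of the limiter only the first and the third contain \<open>u\<close>, with slopes \<open>a\<close> and
  \<open>- m\<close>; the arguments of \<open>low\<close> have slopes between \<open>0\<close> and \<open>1\<close>.
\<close>

lemma rise_change_centre:
  assumes "u \<le> u'"
  shows "\<bar>rise p u' q - rise p u q\<bar> \<le> u' - u"
proof -
  let ?t = "u' - u" and ?L = "max a m * (u' - u)"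
  have t: "0 \<le> ?t" using assms by simp
  have L: "a * ?t \<le> ?L" "m * ?t \<le> ?L" "0 \<le> a * ?t" "0 \<le> m * ?t" "a * ?t \<le> ?t" "m * ?t \<le> ?t"
    using a m t by (auto intro: mult_right_mono mult_left_le_one_le)
  have args: "\<bar>a * (u' - p) - a * (u - p)\<bar> \<le> ?L" "\<bar>m * (q - u') - m * (q - u)\<bar> \<le> ?L"
    using L by (simp_all add: algebra_simps)
  have depth: "\<bar>depth_rise p u' q - depth_rise p u q\<bar> \<le> ?L"
    unfolding depth_rise_def using args L by (intro clamp3_lipschitz) auto
  have surface: "\<bar>surface_rise p u' q - surface_rise p u q\<bar> \<le> ?L"
    unfolding surface_rise_def using args L by (intro clamp3_lipschitz) auto
  have low: "\<bar>low p u' q - low p u q\<bar> \<le> ?t"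
    using L unfolding low_def by (simp add: min_def algebra_simps)
  have "(max a m + g) * ?t \<le> 1 * ?t" using g t by (intro mult_right_mono) auto
  then have "?L + g * ?t \<le> ?t" by (simp add: algebra_simps)
  moreover have "rise p u' q - rise p u q \<le> ?L + g * ?t"
    using depth surface low by (intro rise_increment) auto
  moreover have "rise p u q - rise p u' q \<le> ?L + g * ?t"
    using depth surface low by (intro rise_increment) auto
  ultimately show ?thesis by linarith
qed

text \<open>
  A larger depth on the left raises neither limited rise, and one on the right lowers neither. So
  only the change of the weight can act in the other direction.
\<close>

lemma rise_change_left:
  assumes "p \<le> p'"
  shows "rise p' u q - rise p u q \<le> g * a * (p' - p)"
proof -
  have le: "a * (u - p') \<le> a * (u - p)" "c * (q - p') \<le> c * (q - p)"
    using assms a c by (auto intro: mult_left_mono)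
  have "depth_rise p' u q - depth_rise p u q \<le> 0" "surface_rise p' u q - surface_rise p u q \<le> 0"
    unfolding depth_rise_def surface_rise_def using le by (auto intro!: clamp3_mono)
  moreover have "\<bar>low p' u q - low p u q\<bar> \<le> a * (p' - p)"
    using le(1) unfolding low_def by (simp add: min_def algebra_simps)
  ultimately show ?thesis
    using rise_increment[of p' u q p u q 0 "a * (p' - p)"] by (simp add: mult.assoc)
qed

lemma rise_change_right:
  assumes "q \<le> q'"
  shows "rise p u q - rise p u q' \<le> g * m * (q' - q)"
proof -
  have le: "m * (q - u) \<le> m * (q' - u)" "c * (q - p) \<le> c * (q' - p)"
    using assms m c by (auto intro: mult_left_mono)
  have "depth_rise p u q - depth_rise p u q' \<le> 0" "surface_rise p u q - surface_rise p u q' \<le> 0"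
    unfolding depth_rise_def surface_rise_def using le by (auto intro!: clamp3_mono)
  moreover have "\<bar>low p u q - low p u q'\<bar> \<le> m * (q' - q)"
    using le(1) unfolding low_def by (simp add: min_def algebra_simps)
  ultimately show ?thesis
    using rise_increment[of p u q p u q' 0 "m * (q' - q)"] by (simp add: mult.assoc)
qed

lemma rise_one_sided:
  fixes p u q :: "real \<Rightarrow> real"
  assumes "p field_differentiable (at t within S)" "u field_differentiable (at t within S)"
    "q field_differentiable (at t within S)" and S: "\<And>x. x \<in> S \<Longrightarrow> sgn (x - t) = s"
  shows "(\<lambda>x. rise (p x) (u x) (q x)) field_differentiable (at t within S)"
proof -
  have "0 \<le> B" using B by linarith
  then show ?thesis
    unfolding rise_def depth_rise_def surface_rise_def low_def using assms g(1)
    by (intro blend_one_sided clamp3_one_sided one_sided_intros)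
qed

lemma low_nonneg:
  assumes "0 \<le> p" "0 \<le> u" "0 \<le> q"
  shows "0 \<le> low p u q"
proof -
  have "u - a * (u - p) = (1 - a) * u + a * p" "u + m * (q - u) = (1 - m) * u + m * q"
    by (simp_all add: algebra_simps)
  then show ?thesis using a m assms by (simp add: low_def)
qed

text \<open>
  The depth rise lies between \<open>0\<close> and either of the outer arguments of the limiter, so that the
  purely depth-based interface values lie between \<open>low\<close> and \<open>high\<close>.
\<close>

lemma interface_bounds:
  assumes "0 \<le> p" "0 \<le> u" "0 \<le> q"
  shows "(1 - 1 / xi_crit g) * low p u q \<le> u - rise p u q"
    "u - rise p u q \<le> high p u q + low p u q / xi_crit g"
    "(1 - 1 / xi_crit g) * low p u q \<le> u + rise p u q"
    "u + rise p u q \<le> high p u q + low p u q / xi_crit g"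
proof -
  let ?\<sigma> = "depth_rise p u q"
  have dev: "\<bar>rise p u q - ?\<sigma>\<bar> \<le> low p u q / xi_crit g"
    unfolding rise_def
    by (rule blend_deviation[OF g(1) low_nonneg[OF assms] depth_surface_rise_close])
  have "min 0 (a * (u - p)) \<le> ?\<sigma>" "?\<sigma> \<le> max 0 (a * (u - p))"
    "min 0 (m * (q - u)) \<le> ?\<sigma>" "?\<sigma> \<le> max 0 (m * (q - u))"
    unfolding depth_rise_def by (rule clamp3_between)+
  then have range: "low p u q \<le> u - ?\<sigma>" "u - ?\<sigma> \<le> high p u q"
    "low p u q \<le> u + ?\<sigma>" "u + ?\<sigma> \<le> high p u q"
    unfolding low_def high_def by linarith+
  have "(1 - 1 / xi_crit g) * low p u q = low p u q - low p u q / xi_crit g"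
    by (simp add: algebra_simps)
  then show "(1 - 1 / xi_crit g) * low p u q \<le> u - rise p u q"
    "u - rise p u q \<le> high p u q + low p u q / xi_crit g"
    "(1 - 1 / xi_crit g) * low p u q \<le> u + rise p u q"
    "u + rise p u q \<le> high p u q + low p u q / xi_crit g"
    using dev range by linarith+
qed

end

section \<open>The depth reconstruction\<close>

theorem theorem4p1:
  fixes x \<alpha>p \<alpha>c \<alpha>m bp bm G B h :: "int \<Rightarrow> real" and J j :: int
    and g :: "(int \<Rightarrow> real) \<Rightarrow> int \<Rightarrow> real"
  assumes grid: "strict_mono_on {1..J + 1} x"
    and j: "1 < j" "j < J"
    and alpha: "\<alpha>p j \<in> {0..1}" "\<alpha>c j \<in> {0..1}" "\<alpha>m j \<in> {0..1}"
    and G: "0 < G j" "G j \<le> 1 - max (\<alpha>p j) (\<alpha>m j)"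
    and B: "B j \<ge> Max {\<bar>bed_jump bp bm j / 2 - \<alpha>p j * (bed_mean bp bm j - bed_mean bp bm (j - 1))\<bar>,
                       \<bar>bed_jump bp bm j / 2\<bar>,
                       \<bar>bed_jump bp bm j / 2 - \<alpha>c j * (bed_mean bp bm (j + 1) - bed_mean bp bm (j - 1))\<bar>,
                       \<bar>bed_jump bp bm j / 2 - \<alpha>m j * (bed_mean bp bm (j + 1) - bed_mean bp bm j)\<bar>}"
    and g: "g = blended_grad x \<alpha>p \<alpha>c \<alpha>m bp bm G B"
    and h: "\<forall>k \<in> {1..J}. h k \<ge> 0"
  shows "self_monotone x g h j \<and>
    (partial_ge (left_value x g j) (j - 1) h (- G j * \<alpha>p j) \<and> - G j * \<alpha>p j \<ge> - (1 / 4) \<and>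
     partial_ge (right_value x g j) (j + 1) h (- G j * \<alpha>m j) \<and> - G j * \<alpha>m j \<ge> - (1 / 4)) \<and>
    ((1 - 1 / xi_crit (G j)) * h_down \<alpha>p \<alpha>m h j \<le> left_value x g j h \<and>
     left_value x g j h \<le> h_up \<alpha>p \<alpha>m h j + h_down \<alpha>p \<alpha>m h j / xi_crit (G j) \<and>
     (1 - 1 / xi_crit (G j)) * h_down \<alpha>p \<alpha>m h j \<le> right_value x g j h \<and>
     right_value x g j h \<le> h_up \<alpha>p \<alpha>m h j + h_down \<alpha>p \<alpha>m h j / xi_crit (G j))"
proof -
  \<comment> \<open>a second name, since the interpretation below reuses \<open>g\<close>\<close>
  note gradient = g
  define d where "d = bed_jump bp bm j / 2"
  define e1 where "e1 = \<alpha>p j * (bed_mean bp bm j - bed_mean bp bm (j - 1)) - d"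
  define e2 where "e2 = \<alpha>c j * (bed_mean bp bm (j + 1) - bed_mean bp bm (j - 1)) - d"
  define e3 where "e3 = \<alpha>m j * (bed_mean bp bm (j + 1) - bed_mean bp bm j) - d"
  interpret cell_limiter "\<alpha>p j" "\<alpha>c j" "\<alpha>m j" "G j" "B j" d e1 e2 e3
    using alpha G B unfolding e1_def e2_def e3_def d_def
    by unfold_locales (auto simp: abs_minus_commute)

  have "x j < x (j + 1)"
    using grid j by (auto simp: strict_mono_on_def)
  then have width: "0 < cell_width x j" by (simp add: cell_width_def)
  have low: "h_down \<alpha>p \<alpha>m k j = low (k (j - 1)) (k j) (k (j + 1))" for k
    by (simp add: h_down_def low_def)
  have high: "h_up \<alpha>p \<alpha>m k j = high (k (j - 1)) (k j) (k (j + 1))" for k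
    by (simp add: h_up_def high_def)
  have depth: "cell_width x j / 2 * grad_h x \<alpha>p \<alpha>c \<alpha>m k j
      = depth_rise (k (j - 1)) (k j) (k (j + 1))" for k
    using width by (simp add: grad_h_def limited_slope_def minmod_eq_clamp3 depth_rise_def)
  have surface: "cell_width x j / 2 * grad_eta x \<alpha>p \<alpha>c \<alpha>m bp bm k j
      = surface_rise (k (j - 1)) (k j) (k (j + 1))" for k
  proof -
    let ?\<eta> = "surface bp bm k"
    have "cell_width x j / 2 * grad_eta x \<alpha>p \<alpha>c \<alpha>m bp bm k j
        = clamp3 0 (\<alpha>p j * (?\<eta> j - ?\<eta> (j - 1))) (\<alpha>c j * (?\<eta> (j + 1) - ?\<eta> (j - 1)))
            (\<alpha>m j * (?\<eta> (j + 1) - ?\<eta> j)) + - d"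
      using width
      by (simp add: grad_eta_def limited_slope_def minmod_eq_clamp3 bed_slope_def d_def
          right_diff_distrib)
    also have "\<dots> = surface_rise (k (j - 1)) (k j) (k (j + 1))"
      unfolding clamp3_translate[symmetric] surface_rise_def
      by (simp add: e1_def e2_def e3_def surface_def algebra_simps)
    finally show ?thesis .
  qed
  have rise: "cell_width x j / 2 * g k j = rise (k (j - 1)) (k j) (k (j + 1))" for k
    unfolding gradient blended_grad_def Let_def rise_def blend_def
      low[symmetric] depth[symmetric] surface[symmetric]
    by (simp add: field_simps)
  have left_value: "left_value x g j k = k j - rise (k (j - 1)) (k j) (k (j + 1))"
    and right_value: "right_value x g j k = k j + rise (k (j - 1)) (k j) (k (j + 1))" for k
    unfolding left_value_def right_value_def rise by simp_all

  have "self_monotone x g h j"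
    unfolding self_monotone_def
  proof (intro ballI mono_onI)
    fix y u v :: real
    assume y: "y \<in> cell x j" and uv: "u \<le> v"
    \<comment> \<open>the position of \<open>y\<close> relative to the cell, from \<open>-1\<close> at the left end to \<open>1\<close> at the right end\<close>
    define t where "t = (y - (x j + x (j + 1)) / 2) / (cell_width x j / 2)"
    have t: "\<bar>t\<bar> \<le> 1"
      using y width by (auto simp: t_def cell_def cell_width_def abs_le_iff field_simps)
    let ?s = "\<lambda>u. rise (h (j - 1)) u (h (j + 1))"
    have recon: "recon x g (h(j := u)) j y = u + ?s u * t" for u
    proof -
      have s: "?s u = cell_width x j / 2 * g (h(j := u)) j"
        using rise[of "h(j := u)"] by simp
      have "y - (x j + x (j + 1)) / 2 = cell_width x j / 2 * t"
        using width by (simp add: t_def)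
      then show ?thesis unfolding recon_def s by simp
    qed
    have "\<bar>(?s v - ?s u) * t\<bar> \<le> \<bar>?s v - ?s u\<bar>"
      using t by (simp add: abs_mult mult_left_le)
    also have "\<dots> \<le> v - u" by (rule rise_change_centre[OF uv])
    finally show "recon x g (h(j := u)) j y \<le> recon x g (h(j := v)) j y"
      unfolding recon by (simp add: algebra_simps abs_le_iff)
  qed

  moreover have "partial_ge (left_value x g j) (j - 1) h (- G j * \<alpha>p j)"
  proof (rule partial_ge_of_increments)
    fix u v :: real
    assume "u \<le> v"
    then show "- G j * \<alpha>p j * (v - u)
        \<le> left_value x g j (h(j - 1 := v)) - left_value x g j (h(j - 1 := u))"
      using rise_change_left[of u v "h j" "h (j + 1)"] by (simp add: left_value)
  qed (simp_all add: left_value,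
      (rule field_differentiable_diff field_differentiable_const rise_one_sided
        field_differentiable_ident | simp)+)

  moreover have "partial_ge (right_value x g j) (j + 1) h (- G j * \<alpha>m j)"
  proof (rule partial_ge_of_increments)
    fix u v :: real
    assume "u \<le> v"
    then show "- G j * \<alpha>m j * (v - u)
        \<le> right_value x g j (h(j + 1 := v)) - right_value x g j (h(j + 1 := u))"
      using rise_change_right[of u v "h (j - 1)" "h j"] by (simp add: right_value)
  qed (simp_all add: right_value,
      (rule field_differentiable_add field_differentiable_const rise_one_sided
        field_differentiable_ident | simp)+)

  moreover have "- G j * \<alpha> \<ge> - (1 / 4)" if "0 \<le> \<alpha>" "\<alpha> \<le> max (\<alpha>p j) (\<alpha>m j)" for \<alpha>
  proof -
    have "G j * \<alpha> \<le> (1 - \<alpha>) * \<alpha>"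
      using that G by (intro mult_right_mono) auto
    also have "\<dots> \<le> 1 / 4"
      using zero_le_power2[of "\<alpha> - 1 / 2"] by (simp add: power2_eq_square algebra_simps)
    finally show ?thesis by simp
  qed

  moreover have "0 \<le> h (j - 1)" "0 \<le> h j" "0 \<le> h (j + 1)"
    using h j by auto
  ultimately show ?thesis
    using alpha interface_bounds unfolding low high left_value right_value by simp
qed

end
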